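(* Let $\varphi:\mathbb{D}\to\mathbb{D}$ be a holomorphic self map of the open unit disk $\mathbb{D}$ and let $\theta\in H^\infty(\mathbb{D})$ be an inner function. Then the following statements are equivalent: (a) $\theta H^2$ is an invariant subspace for the composition operator $C_\varphi$ on $H^2$, that is, $C_\varphi(\theta H^2)\subseteq\theta H^2$. (b) $\dfrac{\theta\circ\varphi}{\theta}\in\mathcal{S}(\mathbb{D})$.
   Context: $H^2$ is the Hardy space of holomorphic functions $f$ on $\mathbb{D}=\{z\in\mathbb{C}:|z|<1\}$ with $\sup_{0\le r<1}\frac{1}{2\pi}\int_0^{2\pi}|f(re^{it})|^2\,dt<\infty$. $H^\infty(\mathbb{D})$ is the space of bounded holomorphic functions on $\mathbb{D}$, with the sup norm $\|\cdot\|_\infty$. An inner function is a holomorphic $\theta$ on $\mathbb{D}$ with $|\theta(z)|\le 1$ for all $z\in\mathbb{D}$ and radial limits of modulus one a.e. on $\partial\mathbb{D}$. $\theta H^2=\{\theta h: h\in H^2\}$. The composition operator $C_\varphi$ is the (bounded) operator on $H^2$ given by $C_\varphi f=f\circ\varphi$. The Schur class is $\mathcal{S}(\mathbb{D})=\{\psi\in H^\infty(\mathbb{D}):\|\psi\|_\infty=\sup_{z\in\mathbb{D}}|\psi(z)|\le 1\}$. The condition $\frac{\theta\circ\varphi}{\theta}\in\mathcal{S}(\mathbb{D})$ means that the quotient defines (after removing singularities at zeros of $\theta$) a holomorphic function on $\mathbb{D}$ belonging to $\mathcal{S}(\mathbb{D})$, i.e. there is $f\in\mathcal{S}(\mathbb{D})$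 with $\theta\circ\varphi=\theta f$. *)

theory Defs
  imports "HOL-Complex_Analysis.Complex_Analysis"
begin

text \<open>Functions on the unit disk are represented, as usual for \<^const>\<open>holomorphic_on\<close>, by total
  functions on the complex plane of which only the values on the disk matter.\<close>

abbreviation unit_disk :: "complex set"
  where "unit_disk \<equiv> ball 0 1"

definition circle_mean :: "(complex \<Rightarrow> complex) \<Rightarrow> real \<Rightarrow> real"
  where "circle_mean f r =
    1 / (2 * pi) * integral {0..2 * pi} (\<lambda>t. (cmod (f (of_real r * exp (\<i> * of_real t))))\<^sup>2)"

definition hardy2 :: "(complex \<Rightarrow> complex) set"
  where "hardy2 = {f. f holomorphic_on unit_disk \<and> bdd_above (circle_mean f ` {0..<1})}"

definition hardy_inf :: "(complex \<Rightarrow> complex) set"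
  where "hardy_inf = {f. f holomorphic_on unit_disk \<and> bounded (f ` unit_disk)}"

definition sup_norm :: "(complex \<Rightarrow> complex) \<Rightarrow> real"
  where "sup_norm f = (SUP z\<in>unit_disk. cmod (f z))"

text \<open>The supremum in \<^const>\<open>sup_norm\<close> is only meaningful for bounded functions, which membership
  in \<^const>\<open>hardy_inf\<close> guarantees.\<close>

definition schur_class :: "(complex \<Rightarrow> complex) set"
  where "schur_class = {\<psi> \<in> hardy_inf. sup_norm \<psi> \<le> 1}"

definition inner_function :: "(complex \<Rightarrow> complex) \<Rightarrow> bool"
  where "inner_function \<theta> \<longleftrightarrow>
    \<theta> holomorphic_on unit_disk \<and> (\<forall>z\<in>unit_disk. cmod (\<theta> z) \<le> 1) \<and>
    (AE t in lebesgue_on {0..2 * pi}. \<exists>\<zeta>. cmod \<zeta> = 1 \<and>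
       ((\<lambda>r. \<theta> (of_real r * exp (\<i> * of_real t))) \<longlongrightarrow> \<zeta>) (at_left 1))"

text \<open>The set \<open>\<theta> H\<^sup>2\<close>; the equation is imposed on the disk only, so that membership does not
  depend on values outside the disk.\<close>

definition mult_hardy2 :: "(complex \<Rightarrow> complex) \<Rightarrow> (complex \<Rightarrow> complex) set"
  where "mult_hardy2 \<theta> = {f. \<exists>h\<in>hardy2. \<forall>z\<in>unit_disk. f z = \<theta> z * h z}"

definition composition_op ::
    "(complex \<Rightarrow> complex) \<Rightarrow> (complex \<Rightarrow> complex) \<Rightarrow> complex \<Rightarrow> complex"
  where "composition_op \<phi> f = f \<circ> \<phi>"

end

theory Submission
  imports Defs
begin

text \<open>
  Write \<open>P(z,w) = (|z|\<^sup>2 - |w|\<^sup>2) / |z - w|\<^sup>2\<close> for the Poisson kernel. Both implications rest on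
  one estimate, \<open>norm_le_poisson_integral\<close>: if \<open>F\<close> is holomorphic on the closed disk of
  radius \<open>r\<close>, then \<open>|F(w)|\<close> is at most the average of \<open>P(z,w) |F(z)|\<close> over the circle \<open>|z| = r\<close>.

  If \<open>\<theta> \<circ> \<phi> = \<theta> f\<close> with \<open>f\<close> in the Schur class, then \<open>C\<^sub>\<phi>(\<theta> h) = \<theta> \<cdot> f \<cdot> (h \<circ> \<phi>)\<close>, and multiplication
  by \<open>f\<close> preserves \<open>H\<^sup>2\<close>. So everything reduces to Littlewood's theorem \<open>hardy2_compose\<close> that
  \<open>h \<circ> \<phi>\<close> is in \<open>H\<^sup>2\<close> whenever \<open>h\<close> is. For this, the estimate is applied to \<open>F = h\<^sup>2\<close> at \<open>w = \<phi>(re\<^sup>i\<^sup>s)\<close> and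
  averaged over \<open>s\<close>: the kernel \<open>P(z, \<cdot>)\<close> is the real part of a holomorphic function, hence
  \<open>P(z, \<phi>(re\<^sup>i\<^sup>s))\<close> averages to \<open>P(z, \<phi>(0))\<close>, which is bounded independently of \<open>r\<close>.

  Conversely, invariance applied to \<open>\<theta> = \<theta> \<cdot> 1\<close> gives \<open>\<theta> \<circ> \<phi> = \<theta> h\<close> with \<open>h \<in> H\<^sup>2\<close>, and
  \<open>|\<theta> h| \<le> 1\<close> because \<open>\<phi>\<close> maps the disk to itself. It remains to see that \<open>|h| \<le> 1\<close>
  (\<open>hardy2_quotient_by_inner_bounded\<close>). Boundary values of \<open>h\<close> can be avoided:
  \<open>|h| = |\<theta> h| + |h| (1 - |\<theta>|) \<le> 1 + |h| (1 - |\<theta>|)\<close>, and on the circle of radius \<open>r\<close> the last term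
  tends to \<open>0\<close> in mean as \<open>r \<rightarrow> 1\<close>, since \<open>h\<close> is bounded in \<open>L\<^sup>2\<close> while \<open>1 - |\<theta>|\<close> tends to \<open>0\<close> in
  \<open>L\<^sup>2\<close> by dominated convergence. The Poisson estimate carries the bound from the circles to
  every point of the disk.
\<close>

section \<open>The Poisson integral on a circle\<close>

abbreviation circle_point :: "real \<Rightarrow> real \<Rightarrow> complex"
  where "circle_point r t \<equiv> of_real r * exp (\<i> * of_real t)"

definition poisson_kernel :: "complex \<Rightarrow> complex \<Rightarrow> real"
  where "poisson_kernel z w = ((cmod z)\<^sup>2 - (cmod w)\<^sup>2) / (cmod (z - w))\<^sup>2"

lemma norm_circle_point: "0 \<le> r \<Longrightarrow> cmod (circle_point r t) = r"
  by (simp add: norm_mult)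

lemma continuous_on_circle:
  assumes "continuous_on (cball 0 r) g" "0 \<le> r"
  shows "continuous_on S (\<lambda>t. g (circle_point r t))"
  by (rule continuous_on_compose2[OF assms(1)])
     (use assms in \<open>auto intro!: continuous_intros simp: norm_mult\<close>)

lemma cauchy_integral_on_circle:
  assumes F: "F holomorphic_on cball 0 r" and w: "cmod w < r"
  shows "((\<lambda>t. F (circle_point r t) * (circle_point r t / (circle_point r t - w)))
           has_integral (2 * of_real pi * F w)) {0..2 * pi}"
proof -
  have "((\<lambda>u. F u / (u - w)) has_contour_integral (2 * of_real pi * \<i> * F w)) (circlepath 0 r)"
    by (rule Cauchy_integral_circlepath)
       (use F w in \<open>auto intro: holomorphic_on_imp_continuous_on holomorphic_on_subset\<close>)
  then have "((\<lambda>t. F (0 + of_real r * cis t) / (0 + of_real r * cis t - w) * r * \<i> * cis t)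
      has_integral (2 * of_real pi * \<i> * F w)) {0..2 * pi}"
    unfolding circlepath_def by (subst (asm) has_contour_integral_part_circlepath_iff) auto
  from has_integral_mult_right[OF this, of "-\<i>"] show ?thesis
    by (rule has_integral_eq_rhs[OF has_integral_eq, rotated])
       (auto simp: cis_conv_exp field_simps)
qed

lemma mean_value_on_circle:
  assumes F: "F holomorphic_on cball 0 r" and r: "0 \<le> r"
  shows "((\<lambda>t. F (circle_point r t)) has_integral (2 * of_real pi * F 0)) {0..2 * pi}"
proof (cases "r = 0")
  case True
  then show ?thesis
    using has_integral_const_real[of "F 0" 0 "2 * pi"] by (simp add: scaleR_conv_of_real)
next
  case False
  then show ?thesis
    using cauchy_integral_on_circle[OF F, of 0] r by simp
qed

text \<open>The right-hand side is the real part of a function holomorphic in \<open>w\<close>; this is what makes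
  the kernel obey the mean value property in its second argument.\<close>

lemma poisson_kernel_eq_Re:
  assumes "z \<noteq> w"
  shows "poisson_kernel z w = Re ((z + w) / (z - w))"
proof -
  have "Re ((z + w) / (z - w)) = Re ((z + w) * cnj (z - w)) / (cmod (z - w))\<^sup>2"
    by (simp add: complex_div_cnj[of "z + w"] flip: of_real_power)
  also have "Re ((z + w) * cnj (z - w)) = (cmod z)\<^sup>2 - (cmod w)\<^sup>2"
    by (simp add: cmod_power2 algebra_simps) (simp add: power2_eq_square)
  finally show ?thesis by (simp add: poisson_kernel_def)
qed

lemma poisson_kernel_nonneg: "cmod w \<le> cmod z \<Longrightarrow> 0 \<le> poisson_kernel z w"
  unfolding poisson_kernel_def by (intro divide_nonneg_nonneg) (auto intro: power_mono)

lemma poisson_kernel_le: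
  assumes "cmod w < cmod z"
  shows "poisson_kernel z w \<le> (cmod z + cmod w) / (cmod z - cmod w)"
proof -
  have "poisson_kernel z w \<le> ((cmod z)\<^sup>2 - (cmod w)\<^sup>2) / (cmod z - cmod w)\<^sup>2"
    unfolding poisson_kernel_def
    using assms by (intro divide_left_mono power_mono norm_triangle_ineq2 mult_pos_pos) (auto intro: power_mono)
  also have "(cmod z)\<^sup>2 - (cmod w)\<^sup>2 = (cmod z + cmod w) * (cmod z - cmod w)"
    by (simp add: power2_eq_square algebra_simps)
  also have "\<dots> / (cmod z - cmod w)\<^sup>2 = (cmod z + cmod w) / (cmod z - cmod w)"
    using assms by (simp add: power2_eq_square)
  finally show ?thesis .
qed

lemma continuous_on_poisson_kernel:
  assumes "continuous_on S f" "continuous_on S g" "\<And>x. x \<in> S \<Longrightarrow> f x \<noteq> g x"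
  shows "continuous_on S (\<lambda>x. poisson_kernel (f x) (g x))"
  unfolding poisson_kernel_def using assms by (auto intro!: continuous_intros)

text \<open>Cauchy's formula at \<open>w\<close> applied not to \<open>F\<close> but to \<open>F(z) (r\<^sup>2 - |w|\<^sup>2) / (r\<^sup>2 - cnj w z)\<close>: the extra
  factor equals \<open>1\<close> at \<open>z = w\<close>, and since \<open>r\<^sup>2 = z cnj z\<close> on the circle, it turns the Cauchy
  kernel into the Poisson kernel there.\<close>

lemma poisson_formula:
  assumes F: "F holomorphic_on cball 0 r" and w: "cmod w < r"
  shows "((\<lambda>t. of_real (poisson_kernel (circle_point r t) w) * F (circle_point r t))
           has_integral (2 * of_real pi * F w)) {0..2 * pi}"
proof -
  let ?c = "of_real (r\<^sup>2 - (cmod w)\<^sup>2) :: complex"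
  have r: "0 < r" using w norm_ge_zero[of w] by linarith
  \<comment> \<open>The pole of the extra factor is the reflection of \<open>w\<close> in the circle, outside the closed disk.\<close>
  have nz: "of_real (r\<^sup>2) - cnj w * z \<noteq> 0" if "z \<in> cball 0 r" for z
  proof
    assume "of_real (r\<^sup>2) - cnj w * z = 0"
    then have "cmod (of_real (r\<^sup>2)) = cmod (cnj w * z)" by simp
    then have "r * r = cmod w * cmod z"
      using r by (simp only: norm_mult norm_of_real complex_mod_cnj) (simp add: power2_eq_square)
    moreover have "cmod w * cmod z < r * r"
      using mult_left_mono[of "cmod z" r "cmod w"] mult_strict_right_mono[OF w r] that by simp
    ultimately show False by simp
  qed
  have cw: "of_real (r\<^sup>2) - cnj w * w = ?c"
    by (simp add: complex_norm_square mult.commute del: of_real_power)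
  have "(\<lambda>z. F z * (?c / (of_real (r\<^sup>2) - cnj w * z))) holomorphic_on cball 0 r"
    using nz by (intro holomorphic_intros F) auto
  from cauchy_integral_on_circle[OF this w]
  show ?thesis
  proof (rule has_integral_eq_rhs[OF has_integral_eq, rotated])
    show "2 * of_real pi * F w = 2 * of_real pi * (F w * (?c / (of_real (r\<^sup>2) - cnj w * w)))"
      using nz[of w] w unfolding cw by simp
  next
    fix t :: real
    let ?z = "circle_point r t"
    have z: "cmod ?z = r" using r by (simp add: norm_mult)
    have zz: "of_real (r\<^sup>2) = ?z * cnj ?z" using complex_norm_square[of ?z] z by simp
    have denom: "of_real (r\<^sup>2) - cnj w * ?z = ?z * cnj (?z - w)"
      unfolding zz by (simp add: algebra_simps)
    have nz': "?z \<noteq> 0" "?z - w \<noteq> 0" "cnj (?z - w) \<noteq> 0"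
      using z r w by (auto simp del: complex_cnj_diff)
    have kernel: "of_real (poisson_kernel ?z w) = ?c / ((?z - w) * cnj (?z - w))"
      unfolding poisson_kernel_def z of_real_divide complex_norm_square ..
    show "F ?z * (?c / (of_real (r\<^sup>2) - cnj w * ?z)) * (?z / (?z - w))
        = of_real (poisson_kernel ?z w) * F ?z"
      unfolding denom kernel using nz' by (simp add: divide_simps del: complex_cnj_diff)
  qed
qed

lemma norm_le_poisson_integral:
  assumes F: "F holomorphic_on cball 0 r" and w: "cmod w < r"
  shows "2 * pi * cmod (F w)
    \<le> integral {0..2 * pi} (\<lambda>t. poisson_kernel (circle_point r t) w * cmod (F (circle_point r t)))"
proof -
  have r: "0 < r" using w norm_ge_zero[of w] by linarith
  have c: "continuous_on {0..2*pi} (\<lambda>t. poisson_kernel (circle_point r t) w * cmod (F (circle_point r t)))"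
    using r w norm_circle_point[of r]
    by (intro continuous_intros continuous_on_poisson_kernel continuous_on_circle
          holomorphic_on_imp_continuous_on F) force+
  have "2 * pi * cmod (F w) = cmod (2 * of_real pi * F w)" by (simp add: norm_mult)
  also have "2 * of_real pi * F w = integral {0..2*pi}
      (\<lambda>t. of_real (poisson_kernel (circle_point r t) w) * F (circle_point r t))"
    using poisson_formula[OF F w] by (simp add: integral_unique)
  also have "cmod \<dots> \<le> integral {0..2 * pi}
      (\<lambda>t. poisson_kernel (circle_point r t) w * cmod (F (circle_point r t)))"
    using r w poisson_formula[OF F w]
    by (intro integral_norm_bound_integral integrable_continuous_interval[OF c])
       (auto simp: norm_mult poisson_kernel_nonneg intro: has_integral_integrable)
  finally show ?thesis .
qed

text \<open>Mean value property of the harmonic function \<open>P(\<zeta>, g(\<cdot>))\<close>, the real part of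
  \<open>(\<zeta> + g) / (\<zeta> - g)\<close>.\<close>

lemma integral_poisson_kernel_compose:
  assumes g: "g holomorphic_on cball 0 r" and r: "0 \<le> r"
    and lt: "\<And>z. z \<in> cball 0 r \<Longrightarrow> cmod (g z) < cmod \<zeta>"
  shows "integral {0..2 * pi} (\<lambda>s. poisson_kernel \<zeta> (g (circle_point r s)))
    = 2 * pi * poisson_kernel \<zeta> (g 0)"
proof -
  have Re_2pi: "Re (2 * (of_real pi * x)) = 2 * (pi * Re x)" for x by simp
  have ne: "\<zeta> \<noteq> g z" if "z \<in> cball 0 r" for z using lt[OF that] by auto
  have "(\<lambda>z. (\<zeta> + g z) / (\<zeta> - g z)) holomorphic_on cball 0 r"
    using ne by (intro holomorphic_intros g) auto
  from has_integral_linear[OF mean_value_on_circle[OF this r] bounded_linear_Re]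
  have "((\<lambda>s. Re ((\<zeta> + g (circle_point r s)) / (\<zeta> - g (circle_point r s))))
      has_integral (2 * pi * Re ((\<zeta> + g 0) / (\<zeta> - g 0)))) {0..2 * pi}"
    unfolding o_def mult.assoc by (simp only: Re_2pi)
  moreover have "circle_point r s \<in> cball 0 r" for s using r by (simp add: norm_mult)
  ultimately show ?thesis
    using ne r by (simp add: poisson_kernel_eq_Re integral_unique)
qed

section \<open>Littlewood subordination\<close>

text \<open>Each \<open>|F(g(z))|\<close> is at most a Poisson average of \<open>|F|\<close> over the circle of radius \<open>R\<close>. After
  exchanging the two integrations, the kernel averaged over \<open>z\<close> is the kernel at \<open>g(0)\<close>, and the
  constant is the maximum of that kernel on the circle.\<close>

lemma integral_norm_compose_le:
  assumes F: "F holomorphic_on cball 0 R" and g: "g holomorphic_on cball 0 r" and r: "0 \<le> r"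
    and lt: "\<And>z. z \<in> cball 0 r \<Longrightarrow> cmod (g z) < R"
  shows "integral {0..2 * pi} (\<lambda>s. cmod (F (g (circle_point r s))))
    \<le> (R + cmod (g 0)) / (R - cmod (g 0)) * integral {0..2 * pi} (\<lambda>t. cmod (F (circle_point R t)))"
proof -
  let ?K = "\<lambda>s t. poisson_kernel (circle_point R t) (g (circle_point r s)) * cmod (F (circle_point R t))"
  have in_r: "circle_point r s \<in> cball 0 r" for s using r by (simp add: norm_mult)
  have g0: "cmod (g 0) < R" using lt[of 0] r by simp
  then have R: "0 < R" using norm_ge_zero[of "g 0"] by linarith
  have nR: "cmod (circle_point R t) = R" for t using R by (simp add: norm_mult)
  have ne: "circle_point R t \<noteq> g (circle_point r s)" for s t
    using lt[OF in_r[of s]] nR[of t] by force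
  have cF: "continuous_on (cball 0 R) F" and cg: "continuous_on (cball 0 r) g"
    using F g by (auto intro: holomorphic_on_imp_continuous_on)
  have c2: "continuous_on (cbox (0, 0) (2 * pi, 2 * pi)) (\<lambda>(s, t). ?K s t)"
  proof -
    let ?S = "cbox (0, 0) (2 * pi, 2 * pi)"
    have z: "continuous_on ?S (\<lambda>p. circle_point R (snd p))"
      by (intro continuous_intros)
    have Fz: "continuous_on ?S (\<lambda>p. F (circle_point R (snd p)))"
      by (rule continuous_on_compose2[OF cF z]) (use nR in auto)
    have gz: "continuous_on ?S (\<lambda>p. g (circle_point r (fst p)))"
      by (rule continuous_on_compose2[OF cg]) (use in_r in \<open>auto intro!: continuous_intros\<close>)
    show ?thesis
      unfolding split_def by (intro continuous_on_mult continuous_on_norm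
          continuous_on_poisson_kernel z Fz gz ne)
  qed
  have c1: "continuous_on {0..2 * pi} (\<lambda>s. integral {0..2 * pi} (?K s))"
    using integral_continuous_on_param[of "{0..2*pi}" 0 "2*pi" ?K] c2
    by (simp add: cbox_Pair_eq)
  have cFg: "continuous_on {0..2 * pi} (\<lambda>s. cmod (F (g (circle_point r s))))"
    by (intro continuous_intros continuous_on_compose2[OF cF] continuous_on_circle[OF cg r])
       (use less_imp_le[OF lt[OF in_r]] in auto)
  have cFR: "continuous_on {0..2 * pi} (\<lambda>t. cmod (F (circle_point R t)))"
    using R by (intro continuous_intros continuous_on_circle[OF cF]) simp
  have cP: "continuous_on {0..2 * pi} (\<lambda>t. poisson_kernel (circle_point R t) (g 0))"
    using nR g0 by (intro continuous_on_poisson_kernel continuous_intros) (metis order_less_irrefl)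
  have inner: "integral {0..2 * pi} (\<lambda>s. poisson_kernel (circle_point R t) (g (circle_point r s)))
      = 2 * pi * poisson_kernel (circle_point R t) (g 0)" for t
    by (rule integral_poisson_kernel_compose[OF g r]) (unfold nR, rule lt)
  have "2 * pi * integral {0..2 * pi} (\<lambda>s. cmod (F (g (circle_point r s))))
      = integral {0..2 * pi} (\<lambda>s. 2 * pi * cmod (F (g (circle_point r s))))"
    by simp
  also have "\<dots> \<le> integral {0..2 * pi} (\<lambda>s. integral {0..2 * pi} (?K s))"
    by (intro integral_le integrable_continuous_interval c1 norm_le_poisson_integral[OF F]
          lt in_r continuous_on_mult_left cFg)
  also have "\<dots> = integral {0..2 * pi} (\<lambda>t. integral {0..2 * pi} (\<lambda>s. ?K s t))"
    using integral_swap_continuous[OF c2] by simp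
  also have "\<dots> = integral {0..2 * pi}
      (\<lambda>t. 2 * pi * poisson_kernel (circle_point R t) (g 0) * cmod (F (circle_point R t)))"
    by (simp add: inner)
  also have "\<dots> \<le> integral {0..2 * pi}
      (\<lambda>t. 2 * pi * ((R + cmod (g 0)) / (R - cmod (g 0))) * cmod (F (circle_point R t)))"
  proof (intro integral_le integrable_continuous_interval)
    fix t
    show "2 * pi * poisson_kernel (circle_point R t) (g 0) * cmod (F (circle_point R t))
      \<le> 2 * pi * ((R + cmod (g 0)) / (R - cmod (g 0))) * cmod (F (circle_point R t))"
      using poisson_kernel_le[of "g 0" "circle_point R t"] g0 unfolding nR
      by (intro mult_right_mono mult_left_mono) auto
  qed (intro continuous_intros cP cFR)+
  also have "\<dots> = 2 * pi * ((R + cmod (g 0)) / (R - cmod (g 0))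
      * integral {0..2 * pi} (\<lambda>t. cmod (F (circle_point R t))))"
    by (simp only: integral_mult_right mult.assoc)
  finally show ?thesis by (rule mult_left_le_imp_le) simp
qed

lemma hardy2_circle_mean_bound:
  assumes "h \<in> hardy2"
  obtains M where "\<And>r. 0 \<le> r \<Longrightarrow> r < 1 \<Longrightarrow> circle_mean h r \<le> M"
  using assms that unfolding hardy2_def bdd_above_def by fastforce

text \<open>Littlewood's subordination principle: the preceding inequality is used for the holomorphic
  function \<open>h\<^sup>2\<close>, on a circle whose radius \<open>R\<close> is so close to \<open>1\<close> that it encloses
  \<open>\<phi>\<close> of the closed disk of radius \<open>r\<close>.\<close>

theorem hardy2_compose:
  assumes \<phi>: "\<phi> holomorphic_on unit_disk" "\<phi> ` unit_disk \<subseteq> unit_disk" and h: "h \<in> hardy2"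
  shows "h \<circ> \<phi> \<in> hardy2"
proof -
  have hol: "h holomorphic_on unit_disk" using h by (simp add: hardy2_def)
  obtain M where M: "\<And>r. 0 \<le> r \<Longrightarrow> r < 1 \<Longrightarrow> circle_mean h r \<le> M"
    using hardy2_circle_mean_bound[OF h] by blast
  define a where "a = cmod (\<phi> 0)"
  have "\<phi> 0 \<in> unit_disk" using \<phi>(2) by force
  then have a: "0 \<le> a" "a < 1" by (auto simp: a_def)
  have "circle_mean (h \<circ> \<phi>) r \<le> 4 / (1 - a) * M" if r: "0 \<le> r" "r < 1" for r
  proof -
    have sub: "cball 0 r \<subseteq> unit_disk" using r by auto
    have "continuous_on (cball 0 r) (\<lambda>z. cmod (\<phi> z))"
      by (intro continuous_intros holomorphic_on_imp_continuous_on holomorphic_on_subset[OF \<phi>(1) sub])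
    then obtain b where b_in: "b \<in> cball 0 r" and b: "\<And>z. z \<in> cball 0 r \<Longrightarrow> cmod (\<phi> z) \<le> cmod (\<phi> b)"
      using continuous_attains_sup[of "cball 0 r" "\<lambda>z. cmod (\<phi> z)"] r by auto
    have "\<phi> b \<in> unit_disk" using \<phi>(2) sub b_in by blast
    then have "cmod (\<phi> b) < 1" by simp
    \<comment> \<open>The lower bound \<open>(1 + a) / 2\<close> keeps \<open>(R + a) / (R - a)\<close> below \<open>4 / (1 - a)\<close>, independently of \<open>r\<close>.\<close>
    then obtain R where R: "max (cmod (\<phi> b)) ((1 + a) / 2) < R" "R < 1"
      using dense[of "max (cmod (\<phi> b)) ((1 + a) / 2)" 1] a by auto
    have R0: "0 \<le> R" using R a by auto
    have F: "(\<lambda>z. (h z)\<^sup>2) holomorphic_on cball 0 R"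
      using R by (intro holomorphic_intros holomorphic_on_subset[OF hol]) auto
    have lt: "cmod (\<phi> z) < R" if "z \<in> cball 0 r" for z
      using b[OF that] R by auto
    let ?I = "integral {0..2 * pi} (\<lambda>t. (cmod (h (circle_point R t)))\<^sup>2)"
    have "integral {0..2 * pi} (\<lambda>s. (cmod (h (\<phi> (circle_point r s))))\<^sup>2)
        \<le> (R + a) / (R - a) * ?I"
      using integral_norm_compose_le[OF F holomorphic_on_subset[OF \<phi>(1) sub] r(1) lt]
      by (simp add: norm_power a_def)
    also have "\<dots> \<le> 4 / (1 - a) * ?I"
    proof (rule mult_right_mono)
      have "(R + a) / (R - a) \<le> 2 / ((1 - a) / 2)"
        using R a by (intro frac_le) auto
      then show "(R + a) / (R - a) \<le> 4 / (1 - a)" by simp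
      show "0 \<le> ?I" by (rule integral_nonneg)
         (use R R0 in \<open>auto intro!: integrable_continuous_interval continuous_intros continuous_on_circle
              holomorphic_on_imp_continuous_on holomorphic_on_subset[OF hol]\<close>)
    qed
    finally have "1 / (2 * pi) * integral {0..2 * pi} (\<lambda>s. (cmod (h (\<phi> (circle_point r s))))\<^sup>2)
        \<le> 1 / (2 * pi) * (4 / (1 - a) * ?I)"
      by (rule mult_left_mono) simp
    then have "circle_mean (h \<circ> \<phi>) r \<le> 4 / (1 - a) * circle_mean h R"
      unfolding circle_mean_def o_def by (simp only: mult.left_commute)
    also have "\<dots> \<le> 4 / (1 - a) * M"
      using a R R0 by (intro mult_left_mono M) auto
    finally show ?thesis .
  qed
  then have "bdd_above (circle_mean (h \<circ> \<phi>) ` {0..<1})"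
    by (intro bdd_aboveI2[where M = "4 / (1 - a) * M"]) auto
  then show ?thesis
    using holomorphic_on_compose_gen[OF \<phi>(1) hol \<phi>(2)] by (simp add: hardy2_def)
qed

lemma hardy2_bounded_mult:
  assumes f: "f holomorphic_on unit_disk" "\<And>z. z \<in> unit_disk \<Longrightarrow> cmod (f z) \<le> 1" and h: "h \<in> hardy2"
  shows "(\<lambda>z. f z * h z) \<in> hardy2"
proof -
  have hol: "h holomorphic_on unit_disk" using h by (simp add: hardy2_def)
  have "circle_mean (\<lambda>z. f z * h z) r \<le> circle_mean h r" if r: "0 \<le> r" "r < 1" for r
    unfolding circle_mean_def
  proof (intro mult_left_mono integral_le integrable_continuous_interval)
    fix t
    have "cmod (f (circle_point r t)) * cmod (h (circle_point r t)) \<le> 1 * cmod (h (circle_point r t))"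
      using r by (intro mult_right_mono f) (auto simp: norm_mult)
    then show "(cmod (f (circle_point r t) * h (circle_point r t)))\<^sup>2 \<le> (cmod (h (circle_point r t)))\<^sup>2"
      by (intro power_mono) (auto simp: norm_mult)
  qed (use r in \<open>auto intro!: continuous_intros continuous_on_circle holomorphic_intros
          holomorphic_on_imp_continuous_on holomorphic_on_subset[OF hol] holomorphic_on_subset[OF f(1)]\<close>)
  moreover obtain M where "\<And>r. 0 \<le> r \<Longrightarrow> r < 1 \<Longrightarrow> circle_mean h r \<le> M"
    using hardy2_circle_mean_bound[OF h] by blast
  ultimately have "\<forall>r\<in>{0..<1}. circle_mean (\<lambda>z. f z * h z) r \<le> M"
    by (meson atLeastLessThan_iff order_trans)
  then show ?thesis
    using f(1) hol by (auto simp: hardy2_def bdd_above_def intro!: holomorphic_intros)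
qed

section \<open>Division by an inner function\<close>

text \<open>The only place where the boundary values of the inner function enter: dominated convergence
  turns \<open>|\<theta>| \<rightarrow> 1\<close> along almost every radius into convergence in \<open>L\<^sup>2\<close> along a sequence of circles.\<close>

lemma inner_function_circle_defect_tendsto_0:
  assumes "inner_function \<theta>" and \<rho>: "\<And>n. 0 \<le> \<rho> n" "\<And>n. \<rho> n < 1" "\<rho> \<longlonglongrightarrow> 1"
  shows "(\<lambda>n. integral {0..2 * pi} (\<lambda>t. (1 - cmod (\<theta> (circle_point (\<rho> n) t)))\<^sup>2)) \<longlonglongrightarrow> 0"
proof -
  let ?d = "\<lambda>n t. (1 - cmod (\<theta> (circle_point (\<rho> n) t)))\<^sup>2"
  let ?M = "lebesgue_on {0..2 * pi}"
  have hol: "\<theta> holomorphic_on unit_disk" and le: "\<And>z. z \<in> unit_disk \<Longrightarrow> cmod (\<theta> z) \<le> 1"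
    and bv: "AE t in ?M. \<exists>\<zeta>. cmod \<zeta> = 1 \<and> ((\<lambda>r. \<theta> (circle_point r t)) \<longlongrightarrow> \<zeta>) (at_left 1)"
    using assms(1) by (auto simp: inner_function_def)
  have cont: "continuous_on {0..2 * pi} (?d n)" for n
    using \<rho>(1,2)[of n] by (auto intro!: continuous_intros continuous_on_circle
        holomorphic_on_imp_continuous_on holomorphic_on_subset[OF hol])
  have int: "integrable ?M (?d n)" for n
    by (rule continuous_imp_integrable_real[OF cont])
  have left: "filterlim \<rho> (at_left 1) sequentially"
    using \<rho> by (auto simp: filterlim_at intro!: always_eventually less_imp_neq)
  have "(\<lambda>n. integral\<^sup>L ?M (?d n)) \<longlonglongrightarrow> integral\<^sup>L ?M (\<lambda>t. 0)"
  proof (rule integral_dominated_convergence[where w = "\<lambda>_. 1"])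
    show "AE t in ?M. (\<lambda>n. ?d n t) \<longlonglongrightarrow> 0"
      using bv
    proof eventually_elim
      fix t
      assume "\<exists>\<zeta>. cmod \<zeta> = 1 \<and> ((\<lambda>r. \<theta> (circle_point r t)) \<longlongrightarrow> \<zeta>) (at_left 1)"
      then obtain \<zeta> where \<zeta>: "cmod \<zeta> = 1" "((\<lambda>r. \<theta> (circle_point r t)) \<longlongrightarrow> \<zeta>) (at_left 1)"
        by blast
      have "(\<lambda>n. ?d n t) \<longlonglongrightarrow> (1 - cmod \<zeta>)\<^sup>2"
        by (intro tendsto_intros filterlim_compose[OF \<zeta>(2) left])
      then show "(\<lambda>n. ?d n t) \<longlonglongrightarrow> 0" using \<zeta>(1) by simp
    qed
    show "AE t in ?M. norm (?d n t) \<le> 1" for n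
    proof (rule AE_I2)
      fix t
      have "cmod (\<theta> (circle_point (\<rho> n) t)) \<le> 1" using \<rho>(1,2)[of n] by (intro le) (simp add: norm_mult)
      then show "norm (?d n t) \<le> 1" by (simp add: power_le_one)
    qed
    show "integrable ?M (\<lambda>_. 1 :: real)"
      by (intro continuous_imp_integrable_real continuous_intros)
  qed (use int in auto)
  then show ?thesis
    using lebesgue_integral_eq_integral[OF int] by simp
qed

text \<open>Splits the product of \<open>|h|\<close> and \<open>1 - |\<theta>|\<close> into squares, in place of the Cauchy-Schwarz
  inequality for integrals.\<close>

lemma mult_le_Young:
  fixes x y e :: real
  assumes "0 < e"
  shows "x * y \<le> e * x\<^sup>2 + y\<^sup>2 / (4 * e)"
proof -
  have "0 \<le> (2 * e * x - y)\<^sup>2 / (4 * e)" using assms by simp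
  also have "\<dots> = e * x\<^sup>2 + y\<^sup>2 / (4 * e) - x * y"
    using assms by (simp add: field_simps power2_eq_square)
  finally show ?thesis by simp
qed

text \<open>A maximum principle of Smirnov type: an \<open>H\<^sup>2\<close> function whose product with an inner
  function is bounded by \<open>1\<close> is itself bounded by \<open>1\<close>. For a merely holomorphic \<open>h\<close> it fails: with
  \<open>\<theta>(z) = exp (- (1 + z) / (1 - z))\<close>, the function \<open>h = 1 / \<theta>\<close> is unbounded. The \<open>L\<^sup>2\<close> bound \<open>M\<close> enters
  with a factor \<open>e\<close> that is sent to \<open>0\<close> only after \<open>r \<rightarrow> 1\<close>.\<close>

theorem hardy2_quotient_by_inner_bounded:
  assumes \<theta>: "inner_function \<theta>" and h: "h \<in> hardy2"
    and le1: "\<And>z. z \<in> unit_disk \<Longrightarrow> cmod (\<theta> z * h z) \<le> 1" and w: "w \<in> unit_disk"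
  shows "cmod (h w) \<le> 1"
proof -
  have hol: "h holomorphic_on unit_disk" using h by (simp add: hardy2_def)
  have tol: "\<theta> holomorphic_on unit_disk" and tle: "\<And>z. z \<in> unit_disk \<Longrightarrow> cmod (\<theta> z) \<le> 1"
    using \<theta> by (auto simp: inner_function_def)
  obtain M where M: "\<And>r. 0 \<le> r \<Longrightarrow> r < 1 \<Longrightarrow> circle_mean h r \<le> M"
    using hardy2_circle_mean_bound[OF h] by blast
  define a where "a = cmod w"
  have a: "0 \<le> a" "a < 1" using w by (auto simp: a_def)
  define C where "C = 4 / (1 - a)"
  have C: "0 < C" using a by (simp add: C_def)
  define J where "J r = integral {0..2 * pi} (\<lambda>t. (1 - cmod (\<theta> (circle_point r t)))\<^sup>2)" for r
  \<comment> \<open>\<open>C\<close> bounds the Poisson kernel at \<open>w\<close> on all circles of radius at least \<open>(1 + a) / 2\<close>.\<close>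
  have main: "2 * pi * cmod (h w) \<le> 2 * pi + C * (e * (2 * pi * M) + J r / (4 * e))"
    if e: "0 < e" and r: "(1 + a) / 2 \<le> r" "r < 1" for e r
  proof -
    let ?P = "\<lambda>t. poisson_kernel (circle_point r t) w"
    let ?h = "\<lambda>t. cmod (h (circle_point r t))" and ?d = "\<lambda>t. 1 - cmod (\<theta> (circle_point r t))"
    have r0: "0 \<le> r" "a < r" using r a by auto
    have nr: "cmod (circle_point r t) = r" for t using r0 by (simp add: norm_mult)
    have sub: "cball 0 r \<subseteq> unit_disk" using r by auto
    have ch: "continuous_on {0..2 * pi} ?h" and cd: "continuous_on {0..2 * pi} ?d"
      using sub r0 by (auto intro!: continuous_intros continuous_on_circle
          holomorphic_on_imp_continuous_on holomorphic_on_subset[OF hol] holomorphic_on_subset[OF tol])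
    have cP: "continuous_on {0..2 * pi} ?P"
      using nr r0 by (intro continuous_on_poisson_kernel continuous_intros) (auto simp: a_def)
    have P1: "(?P has_integral 2 * pi) {0..2 * pi}"
    proof -
      have "((\<lambda>t. of_real (?P t) * (1::complex)) has_integral (2 * of_real pi * 1)) {0..2 * pi}"
        by (rule poisson_formula) (use r0 in \<open>auto simp: a_def\<close>)
      from has_integral_linear[OF this bounded_linear_Re] show ?thesis by (simp add: o_def)
    qed
    have "2 * pi * cmod (h w) \<le> integral {0..2 * pi} (\<lambda>t. ?P t * ?h t)"
      using r0 by (intro norm_le_poisson_integral holomorphic_on_subset[OF hol sub]) (simp add: a_def)
    also have "\<dots> \<le> integral {0..2 * pi} (\<lambda>t. ?P t + C * (e * (?h t)\<^sup>2 + (?d t)\<^sup>2 / (4 * e)))"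
    proof (intro integral_le integrable_continuous_interval)
      fix t
      have in_disk: "circle_point r t \<in> unit_disk" using nr r by simp
      have P0: "0 \<le> ?P t" using nr r0 by (intro poisson_kernel_nonneg) (simp add: a_def)
      have "?P t \<le> (r + a) / (r - a)"
        using poisson_kernel_le[of w "circle_point r t"] r0 unfolding nr by (simp add: a_def)
      also have "\<dots> \<le> 2 / ((1 - a) / 2)" using r a by (intro frac_le) auto
      finally have PC: "?P t \<le> C" by (simp add: C_def)
      have d0: "0 \<le> ?d t" using tle[OF in_disk] by simp
      have "?h t = cmod (\<theta> (circle_point r t) * h (circle_point r t)) + ?h t * ?d t"
        by (simp add: norm_mult algebra_simps)
      then have "?h t \<le> 1 + ?h t * ?d t" using le1[OF in_disk] by linarith
      then have "?P t * ?h t \<le> ?P t * (1 + ?h t * ?d t)" using P0 by (rule mult_left_mono)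
      also have "\<dots> = ?P t + ?P t * (?h t * ?d t)" by (simp add: algebra_simps)
      also have "\<dots> \<le> ?P t + C * (?h t * ?d t)"
        using PC d0 by (intro add_left_mono mult_right_mono mult_nonneg_nonneg) auto
      also have "\<dots> \<le> ?P t + C * (e * (?h t)\<^sup>2 + (?d t)\<^sup>2 / (4 * e))"
        using C by (intro add_left_mono mult_left_mono mult_le_Young e) auto
      finally show "?P t * ?h t \<le> ?P t + C * (e * (?h t)\<^sup>2 + (?d t)\<^sup>2 / (4 * e))" .
    qed (use e in \<open>auto intro!: continuous_intros cP ch cd\<close>)
    also have "\<dots> = 2 * pi + C * (e * integral {0..2 * pi} (\<lambda>t. (?h t)\<^sup>2) + J r / (4 * e))"
      unfolding J_def
      by (intro integral_unique has_integral_add P1 has_integral_mult_right has_integral_divide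
            integrable_integral integrable_continuous_interval continuous_intros ch cd)
    also have "integral {0..2 * pi} (\<lambda>t. (?h t)\<^sup>2) = 2 * pi * circle_mean h r"
      by (simp add: circle_mean_def)
    also have "2 * pi + C * (e * (2 * pi * circle_mean h r) + J r / (4 * e))
        \<le> 2 * pi + C * (e * (2 * pi * M) + J r / (4 * e))"
      using C e r0 r by (intro add_left_mono add_right_mono mult_left_mono M) auto
    finally show ?thesis .
  qed
  define \<rho> where "\<rho> n = 1 - (1 - a) / 2 * inverse (real (Suc n))" for n
  have \<rho>: "(1 + a) / 2 \<le> \<rho> n" "\<rho> n < 1" for n
  proof -
    have "inverse (real (Suc n)) \<le> 1" by (simp add: inverse_le_1_iff)
    then have "(1 - a) / 2 * inverse (real (Suc n)) \<le> (1 - a) / 2 * 1"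
      using a by (intro mult_left_mono) auto
    then show "(1 + a) / 2 \<le> \<rho> n" by (simp add: \<rho>_def field_simps)
    show "\<rho> n < 1" using a by (simp add: \<rho>_def)
  qed
  have "\<rho> \<longlonglongrightarrow> 1 - (1 - a) / 2 * 0"
    unfolding \<rho>_def by (intro tendsto_intros LIMSEQ_inverse_real_of_nat)
  then have "\<rho> \<longlonglongrightarrow> 1" by simp
  moreover have "0 \<le> \<rho> n" for n using \<rho>(1)[of n] a by auto
  ultimately have J0: "(\<lambda>n. J (\<rho> n)) \<longlonglongrightarrow> 0"
    unfolding J_def by (intro inner_function_circle_defect_tendsto_0[OF \<theta>] \<rho>(2))
  \<comment> \<open>First \<open>r \<rightarrow> 1\<close> with \<open>e\<close> fixed, which removes the term with \<open>1 / e\<close>; then \<open>e \<rightarrow> 0\<close>.\<close>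
  have eps: "2 * pi * cmod (h w) \<le> 2 * pi + C * (e * (2 * pi * M))" if e: "0 < e" for e
  proof (rule LIMSEQ_le_const)
    have "(\<lambda>n. 2 * pi + C * (e * (2 * pi * M) + J (\<rho> n) / (4 * e)))
        \<longlonglongrightarrow> 2 * pi + C * (e * (2 * pi * M) + 0 / (4 * e))"
      using e by (intro tendsto_intros J0) auto
    then show "(\<lambda>n. 2 * pi + C * (e * (2 * pi * M) + J (\<rho> n) / (4 * e)))
        \<longlonglongrightarrow> 2 * pi + C * (e * (2 * pi * M))" by simp
    show "\<exists>N. \<forall>n\<ge>N. 2 * pi * cmod (h w) \<le> 2 * pi + C * (e * (2 * pi * M) + J (\<rho> n) / (4 * e))"
      using main[OF e \<rho>] by blast
  qed
  have "2 * pi * cmod (h w) \<le> 2 * pi + C * (0 * (2 * pi * M))"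
  proof (rule tendsto_lowerbound[where F = "at_right (0::real)"])
    show "((\<lambda>e. 2 * pi + C * (e * (2 * pi * M))) \<longlongrightarrow> 2 * pi + C * (0 * (2 * pi * M))) (at_right 0)"
      by (intro tendsto_intros)
    show "\<forall>\<^sub>F e in at_right 0. 2 * pi * cmod (h w) \<le> 2 * pi + C * (e * (2 * pi * M))"
      using eps by (auto simp: eventually_at_right_field intro: exI[of _ 1])
  qed simp
  then show ?thesis by simp
qed

section \<open>Invariant subspaces of a composition operator\<close>

lemma schur_class_iff:
  "f \<in> schur_class \<longleftrightarrow> f holomorphic_on unit_disk \<and> (\<forall>z\<in>unit_disk. cmod (f z) \<le> 1)"
proof
  assume f: "f \<in> schur_class"
  then have "bdd_above ((\<lambda>z. cmod (f z)) ` unit_disk)"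
    by (auto simp: schur_class_def hardy_inf_def bounded_iff bdd_above_def)
  then have "cmod (f z) \<le> sup_norm f" if "z \<in> unit_disk" for z
    unfolding sup_norm_def using that by (rule cSUP_upper[rotated])
  then show "f holomorphic_on unit_disk \<and> (\<forall>z\<in>unit_disk. cmod (f z) \<le> 1)"
    using f by (force simp: schur_class_def hardy_inf_def)
next
  assume f: "f holomorphic_on unit_disk \<and> (\<forall>z\<in>unit_disk. cmod (f z) \<le> 1)"
  then have "sup_norm f \<le> 1"
    unfolding sup_norm_def by (intro cSUP_least) auto
  then show "f \<in> schur_class"
    using f by (auto simp: schur_class_def hardy_inf_def bounded_iff)
qed

theorem theorem2p3:
  fixes \<phi> \<theta> :: "complex \<Rightarrow> complex"
  assumes "\<phi> holomorphic_on unit_disk" and "\<phi> ` unit_disk \<subseteq> unit_disk"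
    and "\<theta> \<in> hardy_inf" and "inner_function \<theta>"
  shows "composition_op \<phi> ` mult_hardy2 \<theta> \<subseteq> mult_hardy2 \<theta> \<longleftrightarrow>
    (\<exists>f\<in>schur_class. \<forall>z\<in>unit_disk. \<theta> (\<phi> z) = \<theta> z * f z)"
proof
  assume inv: "composition_op \<phi> ` mult_hardy2 \<theta> \<subseteq> mult_hardy2 \<theta>"
  have "circle_mean (\<lambda>_. 1) r = 1" for r by (simp add: circle_mean_def)
  then have "(\<lambda>_. 1) \<in> hardy2" by (simp add: hardy2_def image_constant_conv)
  then have "\<theta> \<in> mult_hardy2 \<theta>"
    unfolding mult_hardy2_def by (intro CollectI bexI[where x = "\<lambda>_. 1"]) simp_all
  then have "composition_op \<phi> \<theta> \<in> mult_hardy2 \<theta>" using inv by blast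
  then obtain h where h: "h \<in> hardy2" and eq: "\<And>z. z \<in> unit_disk \<Longrightarrow> \<theta> (\<phi> z) = \<theta> z * h z"
    unfolding mult_hardy2_def composition_op_def o_def by blast
  have "cmod (\<theta> z * h z) \<le> 1" if "z \<in> unit_disk" for z
  proof -
    have "\<phi> z \<in> unit_disk" using assms(2) that by blast
    then have "cmod (\<theta> (\<phi> z)) \<le> 1" using assms(4) by (simp add: inner_function_def)
    then show ?thesis by (simp only: eq[OF that])
  qed
  then have "cmod (h z) \<le> 1" if "z \<in> unit_disk" for z
    using hardy2_quotient_by_inner_bounded[OF assms(4) h] that by blast
  then have "h \<in> schur_class" using h by (simp add: schur_class_iff hardy2_def)
  then show "\<exists>f\<in>schur_class. \<forall>z\<in>unit_disk. \<theta> (\<phi> z) = \<theta> z * f z"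
    using eq by blast
next
  assume "\<exists>f\<in>schur_class. \<forall>z\<in>unit_disk. \<theta> (\<phi> z) = \<theta> z * f z"
  then obtain f where "f \<in> schur_class"
    and eq: "\<And>z. z \<in> unit_disk \<Longrightarrow> \<theta> (\<phi> z) = \<theta> z * f z"
    by blast
  then have f: "f holomorphic_on unit_disk" "\<And>z. z \<in> unit_disk \<Longrightarrow> cmod (f z) \<le> 1"
    unfolding schur_class_iff by blast+
  show "composition_op \<phi> ` mult_hardy2 \<theta> \<subseteq> mult_hardy2 \<theta>"
  proof
    fix k assume "k \<in> composition_op \<phi> ` mult_hardy2 \<theta>"
    then obtain g where k: "k = g \<circ> \<phi>" and "g \<in> mult_hardy2 \<theta>"
      unfolding composition_op_def by (rule imageE)
    then obtain h where h: "h \<in> hardy2" and g: "\<And>z. z \<in> unit_disk \<Longrightarrow> g z = \<theta> z * h z"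
      unfolding mult_hardy2_def by blast
    have "k z = \<theta> z * (f z * (h \<circ> \<phi>) z)" if "z \<in> unit_disk" for z
    proof -
      have "\<phi> z \<in> unit_disk" using assms(2) that by blast
      then show ?thesis by (simp only: k o_def g eq[OF that] mult.assoc)
    qed
    moreover have "(\<lambda>z. f z * (h \<circ> \<phi>) z) \<in> hardy2"
      by (rule hardy2_bounded_mult[OF f hardy2_compose[OF assms(1,2) h]])
    ultimately show "k \<in> mult_hardy2 \<theta>"
      unfolding mult_hardy2_def by (intro CollectI bexI ballI)
  qed
qed

end
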